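(* Let $\Omega_1,\mathcal C_1\subset\mathbb R^{n}\times\mathbb R^{s}$ and $\Omega_2,\mathcal C_2\subset\mathbb R^m$ be nonempty sets with $\mathcal C_1,\mathcal C_2$ closed and convex. Define $$\Omega:=\{(x,y,z)\in\mathbb R^n\times\mathbb R^m\times\mathbb R^s\mid(x,z)\in\Omega_1,\ y\in\Omega_2\},\quad \mathcal C:=\{(x,y,z)\in\mathbb R^n\times\mathbb R^m\times\mathbb R^s\mid(x,z)\in\mathcal C_1,\ y\in\mathcal C_2\}.$$ Let $(\bar x,\bar y,\bar z)\in\Omega\cap\mathcal C$ and assume that $\Omega_1$ is locally closed around $(\bar x,\bar z)$ and $\Omega_2$ is locally closed around $\bar y$. Then: (i) $\hat N_{\mathcal C}((\bar x,\bar y,\bar z),\Omega)=\{(x^*,y^*,z^* )\mid(x^*,z^* )\in\hat N_{\mathcal C_1}((\bar x,\bar z),\Omega_1),\ y^*\in\hat N_{\mathcal C_2}(\bar y,\Omega_2)\}$; (ii) $N_{\mathcal C}((\bar x,\bar y,\bar z),\Omega)=\{(x^*,y^*,z^* )\mid(x^*,z^* )\in N_{\mathcal C_1}((\bar x,\bar z),\Omega_1),\ y^*\in N_{\mathcal C_2}(\bar y,\Omega_2)\}$.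
   Context: All spaces are finite-dimensional with scalar product $\langle\cdot,\cdot\rangle$ and a norm; on a product, the norm is the sum of the norms. $x_k\xrightarrow{A}\bar x$ means $x_k\to\bar x$ with $x_k\in A$ for all $k$. A set is locally closed around a point if its intersection with every sufficiently small closed ball centered at the point is closed. For a closed convex set $\mathcal C\subset\mathbb R^d$, a set $\Omega\subset\mathbb R^d$ and $\bar x\in\Omega\cap\mathcal C$, the Fréchet normal cone to $\Omega$ at $\bar x$ with respect to $\mathcal C$ is $$\hat N_{\mathcal C}(\bar x,\Omega):=\Big\{x^*\in\mathbb R^d\mid\exists p>0:\ \bar x+px^*\in\mathcal C,\ \limsup_{x\xrightarrow{\Omega\cap\mathcal C}\bar x}\tfrac{\langle x^*,x-\bar x\rangle}{\|x-\bar x\|}\le0\Big\}$$ (limsup over $x\neq\bar x$; i.e. for every $\epsilon>0$ there is $\delta>0$ with $\langle x^*,x-\bar x\rangle\le\epsilon\|x-\bar x\|$ for all $x\in\Omega\cap\mathcal C$ with $\|x-\bar x\|\le\delta$), and the limiting normal cone with respect to $\mathcal C$, $N_{\mathcal C}(\bar x,\Omega)$, is the set of all $x^*$ for which there are $x_k\xrightarrow{\Omega\cap\mathcal C}\bar x$ and $x_k^*\in\hat N_{\mathcal C}(x_k,\Omega)$ with $x_k^*\to x^*$. *)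

theory Defs
  imports "HOL-Analysis.Analysis"
begin

text \<open>Every space carries an arbitrary norm, and the norm of a product is the sum of the norms of
  the factors. The library norm is always the Euclidean one, also on products, so norms are
  functions of their own. On a finite-dimensional space they all induce the standard topology, which
  is therefore used for convergence and closedness.\<close>

definition is_norm :: "('a::real_vector \<Rightarrow> real) \<Rightarrow> bool" where
  "is_norm N \<longleftrightarrow> (\<forall>x. 0 \<le> N x) \<and> (\<forall>x. N x = 0 \<longleftrightarrow> x = 0) \<and>
     (\<forall>c x. N (c *\<^sub>R x) = \<bar>c\<bar> * N x) \<and> (\<forall>x y. N (x + y) \<le> N x + N y)"

definition sum_norm :: "('a \<Rightarrow> real) \<Rightarrow> ('b \<Rightarrow> real) \<Rightarrow> 'a \<times> 'b \<Rightarrow> real" where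
  "sum_norm N M = (\<lambda>(x, y). N x + M y)"

lemma is_norm_norm: "is_norm (norm :: 'a::real_normed_vector \<Rightarrow> real)"
  by (auto simp: is_norm_def norm_triangle_ineq)

lemma is_norm_sum_norm:
  assumes "is_norm N" "is_norm M"
  shows "is_norm (sum_norm N M)"
  using assms unfolding is_norm_def sum_norm_def
  by (auto simp: zero_prod_def algebra_simps add_nonneg_eq_0_iff)
     (smt (verit))

definition locally_closed_around ::
    "('a::euclidean_space \<Rightarrow> real) \<Rightarrow> 'a set \<Rightarrow> 'a \<Rightarrow> bool" where
  "locally_closed_around N \<Omega> a \<longleftrightarrow>
     (\<exists>r>0. \<forall>\<rho>. 0 < \<rho> \<and> \<rho> \<le> r \<longrightarrow> closed (\<Omega> \<inter> {x. N (x - a) \<le> \<rho>}))"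

text \<open>The upper limit is taken in the extended reals; at an isolated point of \<open>\<Omega> \<inter> C\<close> the filter is
  trivial, the upper limit is \<open>-\<infinity>\<close>, and the condition holds vacuously. Both cones are meant for
  closed convex \<open>C\<close> and \<open>a \<in> \<Omega> \<inter> C\<close>.\<close>

definition frechet_normal_cone ::
    "('a::euclidean_space \<Rightarrow> real) \<Rightarrow> 'a set \<Rightarrow> 'a \<Rightarrow> 'a set \<Rightarrow> 'a set" where
  "frechet_normal_cone N C a \<Omega> =
     {v. (\<exists>p>0. a + p *\<^sub>R v \<in> C) \<and>
         Limsup (at a within \<Omega> \<inter> C) (\<lambda>x. ereal (inner v (x - a) / N (x - a))) \<le> 0}"

definition limiting_normal_cone ::
    "('a::euclidean_space \<Rightarrow> real) \<Rightarrow> 'a set \<Rightarrow> 'a \<Rightarrow> 'a set \<Rightarrow> 'a set" where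
  "limiting_normal_cone N C a \<Omega> =
     {v. \<exists>x w. (\<forall>k::nat. x k \<in> \<Omega> \<inter> C) \<and> x \<longlonglongrightarrow> a \<and>
           (\<forall>k. w k \<in> frechet_normal_cone N C (x k) \<Omega>) \<and> w \<longlonglongrightarrow> v}"

end

theory Submission
  imports Defs
begin

text \<open>The normal cone condition on a product splits because both the scalar product and the norm of
  the product are sums over the factors: restricting to points that differ from the base point in one
  factor only gives one inclusion, adding the two estimates gives the other, and convexity turns the
  two step lengths \<open>p\<close> into a common one.\<close>

text \<open>The denominator can be cleared because \<open>N (x - a) > 0\<close> away from
  \<open>a\<close>. Without quotients and upper limits, estimates in the two factors can be added or
  restricted. Nearness is measured by \<open>dist\<close>, which generates the filter of the
  \<open>Limsup\<close>; the chosen norm \<open>N\<close> enters only through the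
  inequality.\<close>

lemma frechet_normal_cone_iff:
  assumes "is_norm N"
  shows "v \<in> frechet_normal_cone N C a \<Omega> \<longleftrightarrow>
    (\<exists>p>0. a + p *\<^sub>R v \<in> C) \<and>
    (\<forall>e>0. \<exists>d>0. \<forall>x\<in>\<Omega> \<inter> C. dist x a < d \<longrightarrow> inner v (x - a) \<le> e * N (x - a))"
    (is "_ \<longleftrightarrow> _ \<and> ?R")
proof -
  have pos: "N (x - a) > 0" if "x \<noteq> a" for x
    using assms that unfolding is_norm_def by (metis less_eq_real_def right_minus_eq)
  have zero: "N 0 = 0"
    using assms by (simp add: is_norm_def)
  have "Limsup (at a within \<Omega> \<inter> C) (\<lambda>x. ereal (inner v (x - a) / N (x - a))) \<le> 0 \<longleftrightarrow> ?R"
    (is "Limsup ?F ?f \<le> 0 \<longleftrightarrow> _")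
  proof
    assume L: "Limsup ?F ?f \<le> 0"
    show ?R
    proof (intro allI impI)
      fix e :: real assume "e > 0"
      then have "0 < ereal e"
        by simp
      with L have "\<forall>\<^sub>F x in ?F. ?f x < ereal e"
        unfolding Limsup_le_iff by blast
      then obtain d where "d > 0"
        and d: "\<And>x. x \<in> \<Omega> \<inter> C \<Longrightarrow> x \<noteq> a \<Longrightarrow> dist x a < d \<Longrightarrow> ?f x < ereal e"
        unfolding eventually_at by blast
      \<comment> \<open>The filter says nothing about \<open>x = a\<close>; there both sides vanish
        because \<open>N 0 = 0\<close>.\<close>
      have "inner v (x - a) \<le> e * N (x - a)" if "x \<in> \<Omega> \<inter> C" "dist x a < d" for x
      proof (cases "x = a")
        case False
        then show ?thesis
          using d[OF that(1) False that(2)] pos[OF False] by (simp add: pos_divide_less_eq)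
      qed (simp add: zero)
      with \<open>d > 0\<close> show "\<exists>d>0. \<forall>x\<in>\<Omega> \<inter> C. dist x a < d \<longrightarrow> inner v (x - a) \<le> e * N (x - a)"
        by blast
    qed
  next
    assume R: ?R
    show "Limsup ?F ?f \<le> 0"
      unfolding Limsup_le_iff
    proof (intro allI impI)
      fix c :: ereal assume "0 < c"
      \<comment> \<open>The bound \<open>c\<close> may be infinite, so a real tolerance is chosen
        strictly between 0 and \<open>c\<close>. The gap \<open>ereal e < c\<close> also turns the
        weak inequality of \<open>?R\<close> into the strict one demanded by the
        \<open>Limsup\<close>.\<close>
      then obtain e where "0 < ereal e" and e: "ereal e < c"
        using ereal_dense2 by blast
      with R obtain d where "d > 0"
        and d: "\<And>x. x \<in> \<Omega> \<inter> C \<Longrightarrow> dist x a < d \<Longrightarrow> inner v (x - a) \<le> e * N (x - a)"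
        by (metis ereal_less(2))
      have "?f x < c" if "x \<in> \<Omega> \<inter> C" "x \<noteq> a" "dist x a < d" for x
        using d[OF that(1,3)] pos[OF that(2)] e
        by (metis ereal_less_eq(3) le_less_trans pos_divide_le_eq)
      with \<open>d > 0\<close> show "\<forall>\<^sub>F x in ?F. ?f x < c"
        unfolding eventually_at by blast
    qed
  qed
  then show ?thesis
    by (simp add: frechet_normal_cone_def)
qed

text \<open>The shorter step ends on the segment from \<open>a\<close> to
  \<open>a + p *\<^sub>R v\<close>, at weight \<open>q / p\<close>. This allows different step
  lengths in two factors to be replaced by their minimum.\<close>

lemma convex_step_shorten:
  fixes C :: "'a::real_vector set"
  assumes "convex C" "a \<in> C" "a + p *\<^sub>R v \<in> C" "0 < q" "q \<le> p"
  shows "a + q *\<^sub>R v \<in> C"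
proof -
  have "(1 - q / p) *\<^sub>R a + (q / p) *\<^sub>R (a + p *\<^sub>R v) \<in> C"
    using assms by (intro convexD) auto
  moreover have "(1 - q / p) *\<^sub>R a + (q / p) *\<^sub>R (a + p *\<^sub>R v) = a + q *\<^sub>R v"
    using assms by (simp add: algebra_simps)
  ultimately show ?thesis by simp
qed

text \<open>This is the Cartesian product of \<open>A\<close> and \<open>B\<close> up to the
  coordinate permutation taking \<open>((x, z), y)\<close> to \<open>(x, y, z)\<close>. The same
  operation describes the sets, the constraints and both kinds of cones.\<close>

definition interleave :: "('a \<times> 'c) set \<Rightarrow> 'b set \<Rightarrow> ('a \<times> 'b \<times> 'c) set" where
  "interleave A B = {(x, y, z). (x, z) \<in> A \<and> y \<in> B}"

lemma mem_interleave [simp]: "(x, y, z) \<in> interleave A B \<longleftrightarrow> (x, z) \<in> A \<and> y \<in> B"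
  by (simp add: interleave_def)

text \<open>The base point is an arbitrary point of the two intersections, so the equality can later
  be applied at every member of an approximating sequence.\<close>

lemma frechet_normal_cone_interleave:
  fixes x :: "'a::euclidean_space" and y :: "'b::euclidean_space" and z :: "'c::euclidean_space"
  assumes N: "is_norm Nx" "is_norm Ny" "is_norm Nz"
    and cvx: "convex C\<^sub>1" "convex C\<^sub>2"
    and xz: "(x, z) \<in> \<Omega>\<^sub>1 \<inter> C\<^sub>1" and y: "y \<in> \<Omega>\<^sub>2 \<inter> C\<^sub>2"
  shows "frechet_normal_cone (sum_norm Nx (sum_norm Ny Nz)) (interleave C\<^sub>1 C\<^sub>2) (x, y, z)
      (interleave \<Omega>\<^sub>1 \<Omega>\<^sub>2) =
    interleave (frechet_normal_cone (sum_norm Nx Nz) C\<^sub>1 (x, z) \<Omega>\<^sub>1) (frechet_normal_cone Ny C\<^sub>2 y \<Omega>\<^sub>2)"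
    (is "?L = ?R")
proof -
  let ?N = "sum_norm Nx (sum_norm Ny Nz)" and ?N1 = "sum_norm Nx Nz"
  let ?C = "interleave C\<^sub>1 C\<^sub>2" and ?\<Omega> = "interleave \<Omega>\<^sub>1 \<Omega>\<^sub>2"
  note iff = frechet_normal_cone_iff[OF is_norm_sum_norm[OF N(1) is_norm_sum_norm[OF N(2,3)]]]
    frechet_normal_cone_iff[OF is_norm_sum_norm[OF N(1,3)]] frechet_normal_cone_iff[OF N(2)]
  have zero: "Nx 0 = 0" "Ny 0 = 0" "Nz 0 = 0"
    using N by (simp_all add: is_norm_def)
  have "(u, v, w) \<in> ?L \<longleftrightarrow> (u, v, w) \<in> ?R" for u v w
  proof
    assume L: "(u, v, w) \<in> ?L"
    then have step: "\<exists>p>0. (x, z) + p *\<^sub>R (u, w) \<in> C\<^sub>1" "\<exists>p>0. y + p *\<^sub>R v \<in> C\<^sub>2"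
      by (auto simp: iff)
    have near: "\<exists>d>0. \<forall>t\<in>?\<Omega> \<inter> ?C. dist t (x, y, z) < d \<longrightarrow>
        inner (u, v, w) (t - (x, y, z)) \<le> e * ?N (t - (x, y, z))" if "e > 0" for e
      using L that by (simp only: iff)
    have "\<exists>d>0. \<forall>t\<in>\<Omega>\<^sub>1 \<inter> C\<^sub>1. dist t (x, z) < d \<longrightarrow>
        inner (u, w) (t - (x, z)) \<le> e * ?N1 (t - (x, z))" if e: "e > 0" for e
    proof -
      obtain d where "d > 0" and d: "\<And>t. t \<in> ?\<Omega> \<inter> ?C \<Longrightarrow> dist t (x, y, z) < d \<Longrightarrow>
          inner (u, v, w) (t - (x, y, z)) \<le> e * ?N (t - (x, y, z))"
        using near[OF e] by blast
      \<comment> \<open>The test point \<open>(x', y, z')\<close> keeps the middle coordinate fixed.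
        It is admissible because \<open>y\<close> lies in
        \<open>\<Omega>\<^sub>2 \<inter> C\<^sub>2\<close>, it has the same distance from the base
        point, and its \<open>v\<close> and \<open>Ny\<close> terms vanish.\<close>
      have "inner (u, w) ((x', z') - (x, z)) \<le> e * ?N1 ((x', z') - (x, z))"
        if "(x', z') \<in> \<Omega>\<^sub>1 \<inter> C\<^sub>1" "dist (x', z') (x, z) < d" for x' z'
        using d[of "(x', y, z')"] that y by (simp add: dist_Pair_Pair sum_norm_def zero)
      with \<open>d > 0\<close> show ?thesis by auto
    qed
    moreover have "\<exists>d>0. \<forall>t\<in>\<Omega>\<^sub>2 \<inter> C\<^sub>2. dist t y < d \<longrightarrow>
        inner v (t - y) \<le> e * Ny (t - y)" if e: "e > 0" for e
    proof -
      obtain d where "d > 0" and d: "\<And>t. t \<in> ?\<Omega> \<inter> ?C \<Longrightarrow> dist t (x, y, z) < d \<Longrightarrow>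
          inner (u, v, w) (t - (x, y, z)) \<le> e * ?N (t - (x, y, z))"
        using near[OF e] by blast
      \<comment> \<open>Now the outer coordinates are fixed at \<open>x\<close> and
        \<open>z\<close>, and only the middle one moves.\<close>
      have "inner v (t - y) \<le> e * Ny (t - y)" if "t \<in> \<Omega>\<^sub>2 \<inter> C\<^sub>2" "dist t y < d" for t
        using d[of "(x, t, z)"] that xz by (simp add: dist_Pair_Pair sum_norm_def zero)
      with \<open>d > 0\<close> show ?thesis by blast
    qed
    ultimately show "(u, v, w) \<in> ?R"
      using step by (simp only: mem_interleave iff) blast
  next
    assume R: "(u, v, w) \<in> ?R"
    then obtain p q where "p > 0" "q > 0"
      and pq: "(x, z) + p *\<^sub>R (u, w) \<in> C\<^sub>1" "y + q *\<^sub>R v \<in> C\<^sub>2"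
      unfolding mem_interleave iff by blast
    have near1: "\<exists>d>0. \<forall>t\<in>\<Omega>\<^sub>1 \<inter> C\<^sub>1. dist t (x, z) < d \<longrightarrow>
        inner (u, w) (t - (x, z)) \<le> e * ?N1 (t - (x, z))" if "e > 0" for e
      using R that by (simp only: mem_interleave iff)
    have near2: "\<exists>d>0. \<forall>t\<in>\<Omega>\<^sub>2 \<inter> C\<^sub>2. dist t y < d \<longrightarrow>
        inner v (t - y) \<le> e * Ny (t - y)" if "e > 0" for e
      using R that by (simp only: mem_interleave iff)
    \<comment> \<open>Both base points lie in their convex sets, so each step can be shortened to
      the smaller of the two.\<close>
    have "(x, z) + min p q *\<^sub>R (u, w) \<in> C\<^sub>1" "y + min p q *\<^sub>R v \<in> C\<^sub>2"
      using convex_step_shorten[OF cvx(1) _ pq(1)] convex_step_shorten[OF cvx(2) _ pq(2)]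
        \<open>p > 0\<close> \<open>q > 0\<close> xz y by auto
    then have "(x, y, z) + min p q *\<^sub>R (u, v, w) \<in> ?C"
      by simp
    then have "\<exists>p>0. (x, y, z) + p *\<^sub>R (u, v, w) \<in> ?C"
      using \<open>p > 0\<close> \<open>q > 0\<close> by (metis min_less_iff_conj)
    moreover have "\<exists>d>0. \<forall>t\<in>?\<Omega> \<inter> ?C. dist t (x, y, z) < d \<longrightarrow>
        inner (u, v, w) (t - (x, y, z)) \<le> e * ?N (t - (x, y, z))" if e: "e > 0" for e
    proof -
      obtain d1 where "d1 > 0" and d1: "\<And>t. t \<in> \<Omega>\<^sub>1 \<inter> C\<^sub>1 \<Longrightarrow> dist t (x, z) < d1 \<Longrightarrow>
          inner (u, w) (t - (x, z)) \<le> e * ?N1 (t - (x, z))"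
        using near1[OF e] by blast
      obtain d2 where "d2 > 0" and d2: "\<And>t. t \<in> \<Omega>\<^sub>2 \<inter> C\<^sub>2 \<Longrightarrow> dist t y < d2 \<Longrightarrow>
          inner v (t - y) \<le> e * Ny (t - y)"
        using near2[OF e] by blast
      have "inner (u, v, w) ((x', y', z') - (x, y, z)) \<le> e * ?N ((x', y', z') - (x, y, z))"
        if mem: "(x', y', z') \<in> ?\<Omega> \<inter> ?C" and "dist (x', y', z') (x, y, z) < min d1 d2" for x' y' z'
      proof -
        \<comment> \<open>Projections do not increase Euclidean distance, so the radius
          \<open>min d1 d2\<close> puts both projected points within reach of \<open>d1\<close> and
          \<open>d2\<close>. The two estimates then add up with the same \<open>e\<close>, since
          \<open>?N\<close> is exactly the sum of \<open>?N1\<close> and \<open>Ny\<close> on the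
          respective coordinates.\<close>
        have "dist (x', z') (x, z) \<le> dist (x', y', z') (x, y, z)"
          "dist y' y \<le> dist (x', y', z') (x, y, z)"
          by (auto simp: dist_Pair_Pair intro!: real_le_rsqrt)
        then show ?thesis
          using d1[of "(x', z')"] d2[of y'] that by (simp add: sum_norm_def algebra_simps)
      qed
      with \<open>d1 > 0\<close> \<open>d2 > 0\<close> show ?thesis
        by (intro exI[of _ "min d1 d2"]) auto
    qed
    ultimately show "(u, v, w) \<in> ?L"
      by (simp only: iff) blast
  qed
  then show ?thesis by auto
qed

lemma limiting_normal_coneI:
  assumes "\<And>k::nat. x k \<in> \<Omega> \<inter> C" "\<And>k. w k \<in> frechet_normal_cone N C (x k) \<Omega>"
    and "x \<longlonglongrightarrow> a" "w \<longlonglongrightarrow> v"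
  shows "v \<in> limiting_normal_cone N C a \<Omega>"
  using assms unfolding limiting_normal_cone_def by blast

text \<open>Convergence in a product is coordinatewise, so sequences of base points and normals can
  be split and merged termwise, with the equality of Frechet cones applied at each index.\<close>

lemma limiting_normal_cone_interleave:
  fixes x :: "'a::euclidean_space" and y :: "'b::euclidean_space" and z :: "'c::euclidean_space"
  assumes N: "is_norm Nx" "is_norm Ny" "is_norm Nz"
    and cvx: "convex C\<^sub>1" "convex C\<^sub>2"
  shows "limiting_normal_cone (sum_norm Nx (sum_norm Ny Nz)) (interleave C\<^sub>1 C\<^sub>2) (x, y, z)
      (interleave \<Omega>\<^sub>1 \<Omega>\<^sub>2) =
    interleave (limiting_normal_cone (sum_norm Nx Nz) C\<^sub>1 (x, z) \<Omega>\<^sub>1) (limiting_normal_cone Ny C\<^sub>2 y \<Omega>\<^sub>2)"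
    (is "?L = ?R")
proof -
  let ?N = "sum_norm Nx (sum_norm Ny Nz)" and ?N1 = "sum_norm Nx Nz"
  let ?C = "interleave C\<^sub>1 C\<^sub>2" and ?\<Omega> = "interleave \<Omega>\<^sub>1 \<Omega>\<^sub>2"
  note frechet = frechet_normal_cone_interleave[OF N cvx]
  have "(u, v, w) \<in> ?L \<longleftrightarrow> (u, v, w) \<in> ?R" for u v w
  proof
    assume "(u, v, w) \<in> ?L"
    then obtain s t where s: "\<And>k::nat. s k \<in> ?\<Omega> \<inter> ?C" "s \<longlonglongrightarrow> (x, y, z)"
      and t: "\<And>k. t k \<in> frechet_normal_cone ?N ?C (s k) ?\<Omega>" "t \<longlonglongrightarrow> (u, v, w)"
      unfolding limiting_normal_cone_def by blast
    \<comment> \<open>Together these two projections undo the interleaving.\<close>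
    define drop_mid :: "'a \<times> 'b \<times> 'c \<Rightarrow> 'a \<times> 'c" where "drop_mid = (\<lambda>p. (fst p, snd (snd p)))"
    define mid :: "'a \<times> 'b \<times> 'c \<Rightarrow> 'b" where "mid = (\<lambda>p. fst (snd p))"
    \<comment> \<open>The Frechet equality applies at \<open>s k\<close> only once its projections
      are known to be admissible base points.\<close>
    have mem: "drop_mid (s k) \<in> \<Omega>\<^sub>1 \<inter> C\<^sub>1" "mid (s k) \<in> \<Omega>\<^sub>2 \<inter> C\<^sub>2" for k
      using s(1)[of k] by (cases "s k"; simp add: drop_mid_def mid_def)+
    have "drop_mid (t k) \<in> frechet_normal_cone ?N1 C\<^sub>1 (drop_mid (s k)) \<Omega>\<^sub>1"
      "mid (t k) \<in> frechet_normal_cone Ny C\<^sub>2 (mid (s k)) \<Omega>\<^sub>2" for k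
      using t(1)[of k] mem[of k]
      by (cases "s k"; cases "t k"; simp add: drop_mid_def mid_def frechet)+
    moreover have "(\<lambda>k. drop_mid (s k)) \<longlonglongrightarrow> (x, z)" "(\<lambda>k. mid (s k)) \<longlonglongrightarrow> y"
      "(\<lambda>k. drop_mid (t k)) \<longlonglongrightarrow> (u, w)" "(\<lambda>k. mid (t k)) \<longlonglongrightarrow> v"
      using tendsto_fst[OF s(2)] tendsto_fst[OF tendsto_snd[OF s(2)]]
        tendsto_snd[OF tendsto_snd[OF s(2)]] tendsto_fst[OF t(2)]
        tendsto_fst[OF tendsto_snd[OF t(2)]] tendsto_snd[OF tendsto_snd[OF t(2)]]
      by (auto simp: drop_mid_def mid_def intro!: tendsto_Pair)
    ultimately show "(u, v, w) \<in> ?R"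
      using mem unfolding mem_interleave
      by (intro conjI limiting_normal_coneI[where x = "\<lambda>k. drop_mid (s k)" and w = "\<lambda>k. drop_mid (t k)"]
          limiting_normal_coneI[where x = "\<lambda>k. mid (s k)" and w = "\<lambda>k. mid (t k)"])
  next
    assume R: "(u, v, w) \<in> ?R"
    then obtain s t where s: "\<And>k::nat. s k \<in> \<Omega>\<^sub>1 \<inter> C\<^sub>1" "s \<longlonglongrightarrow> (x, z)"
      and t: "\<And>k. t k \<in> frechet_normal_cone ?N1 C\<^sub>1 (s k) \<Omega>\<^sub>1" "t \<longlonglongrightarrow> (u, w)"
      unfolding mem_interleave limiting_normal_cone_def by blast
    obtain s' t' where s': "\<And>k::nat. s' k \<in> \<Omega>\<^sub>2 \<inter> C\<^sub>2" "s' \<longlonglongrightarrow> y"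
      and t': "\<And>k. t' k \<in> frechet_normal_cone Ny C\<^sub>2 (s' k) \<Omega>\<^sub>2" "t' \<longlonglongrightarrow> v"
      using R unfolding mem_interleave limiting_normal_cone_def by blast
    \<comment> \<open>The sequences for the two factors are chosen independently but share the index
      set, so they are merged index by index without passing to subsequences.\<close>
    let ?S = "\<lambda>k. (fst (s k), s' k, snd (s k))" and ?T = "\<lambda>k. (fst (t k), t' k, snd (t k))"
    have "?S k \<in> ?\<Omega> \<inter> ?C" for k
      using s(1)[of k] s'(1)[of k] by simp
    moreover have "?T k \<in> frechet_normal_cone ?N ?C (?S k) ?\<Omega>" for k
      using s(1)[of k] s'(1)[of k] t(1)[of k] t'(1)[of k] by (simp add: frechet)
    moreover have "?S \<longlonglongrightarrow> (x, y, z)" "?T \<longlonglongrightarrow> (u, v, w)"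
      using tendsto_fst[OF s(2)] tendsto_snd[OF s(2)] tendsto_fst[OF t(2)] tendsto_snd[OF t(2)]
        s'(2) t'(2) by (auto intro!: tendsto_Pair)
    ultimately show "(u, v, w) \<in> ?L"
      by (rule limiting_normal_coneI[where x = ?S and w = ?T])
  qed
  then show ?thesis by auto
qed

theorem theorem8:
  fixes Nx :: "real ^ 'n \<Rightarrow> real" and Ny :: "real ^ 'm \<Rightarrow> real" and Nz :: "real ^ 's \<Rightarrow> real"
    and \<Omega>\<^sub>1 C\<^sub>1 :: "((real ^ 'n) \<times> (real ^ 's)) set"
    and \<Omega>\<^sub>2 C\<^sub>2 :: "(real ^ 'm) set"
    and \<Omega> C :: "((real ^ 'n) \<times> (real ^ 'm) \<times> (real ^ 's)) set"
    and x :: "(real ^ 'n)" and y :: "(real ^ 'm)" and z :: "(real ^ 's)"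
  assumes "is_norm Nx" and "is_norm Ny" and "is_norm Nz"
    and "\<Omega>\<^sub>1 \<noteq> {}" and "\<Omega>\<^sub>2 \<noteq> {}"
    and "C\<^sub>1 \<noteq> {}" and "closed C\<^sub>1" and "convex C\<^sub>1"
    and "C\<^sub>2 \<noteq> {}" and "closed C\<^sub>2" and "convex C\<^sub>2"
    and "\<Omega> = {(x, y, z). (x, z) \<in> \<Omega>\<^sub>1 \<and> y \<in> \<Omega>\<^sub>2}"
    and "C = {(x, y, z). (x, z) \<in> C\<^sub>1 \<and> y \<in> C\<^sub>2}"
    and "(x, y, z) \<in> \<Omega> \<inter> C"
    and "locally_closed_around (sum_norm Nx Nz) \<Omega>\<^sub>1 (x, z)"
    and "locally_closed_around Ny \<Omega>\<^sub>2 y"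
  shows "frechet_normal_cone (sum_norm Nx (sum_norm Ny Nz)) C (x, y, z) \<Omega> =
           {(u, v, w). (u, w) \<in> frechet_normal_cone (sum_norm Nx Nz) C\<^sub>1 (x, z) \<Omega>\<^sub>1 \<and>
                       v \<in> frechet_normal_cone Ny C\<^sub>2 y \<Omega>\<^sub>2} \<and>
         limiting_normal_cone (sum_norm Nx (sum_norm Ny Nz)) C (x, y, z) \<Omega> =
           {(u, v, w). (u, w) \<in> limiting_normal_cone (sum_norm Nx Nz) C\<^sub>1 (x, z) \<Omega>\<^sub>1 \<and>
                       v \<in> limiting_normal_cone Ny C\<^sub>2 y \<Omega>\<^sub>2}"
proof -
  have "\<Omega> = interleave \<Omega>\<^sub>1 \<Omega>\<^sub>2" "C = interleave C\<^sub>1 C\<^sub>2"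
    using assms by (simp_all add: interleave_def)
  moreover have "(x, z) \<in> \<Omega>\<^sub>1 \<inter> C\<^sub>1" "y \<in> \<Omega>\<^sub>2 \<inter> C\<^sub>2"
    using assms by auto
  ultimately show ?thesis
    \<comment> \<open>Only interleavings of cones are unfolded; those of the sets stay folded so
      that the two equalities still match.\<close>
    using assms by (simp add: frechet_normal_cone_interleave limiting_normal_cone_interleave
        interleave_def[of "frechet_normal_cone _ _ _ _"]
        interleave_def[of "limiting_normal_cone _ _ _ _"])
qed

end
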